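(* Let $X$ be a topological space such that $|X|\geq\mathfrak d$. Then $X$ is not M-nw-selective.
   Context: A network for a space $X$ is a family $\mathcal N$ of subsets of $X$ such that for every $x\in X$ and every open neighbourhood $U$ of $x$ there is $N\in\mathcal N$ with $x\in N\subseteq U$. The net weight $nw(X)$ is the least cardinality of a network for $X$; $nw(X)=\omega$ is understood as: $X$ has a countable network. A space $X$ is M-nw-selective if $nw(X)=\omega$ and for every sequence $(\mathcal N_n:n\in\omega)$ of countable networks for $X$ one can select finite $\mathcal F_n\subset\mathcal N_n$, $n\in\omega$, such that $\bigcup_{n\in\omega}\mathcal F_n$ is a network for $X$. For $f,g\in\omega^\omega$, $f\leq^* g$ means $f(n)\leq g(n)$ for all but finitely many $n$. A set $D\subseteq\omega^\omega$ is dominating if for each $g\in\omega^\omega$ there is $f\in D$ with $g\leq^* f$; $\mathfrak d$ is the minimal cardinality of a dominating subset of $\omega^\omega$. *)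

theory Defs
  imports "HOL-Analysis.Abstract_Topology"
begin

unbundle cardinal_syntax

definition network :: "'a topology \<Rightarrow> 'a set set \<Rightarrow> bool" where
  "network X \<N> \<longleftrightarrow>
     \<N> \<subseteq> Pow (topspace X) \<and>
     (\<forall>x U. openin X U \<and> x \<in> U \<longrightarrow> (\<exists>N\<in>\<N>. x \<in> N \<and> N \<subseteq> U))"

(* Countable means finite or countably infinite; the first conjunct is nw(X) = omega,
   i.e. X has a countable network. *)
definition M_nw_selective :: "'a topology \<Rightarrow> bool" where
  "M_nw_selective X \<longleftrightarrow>
     (\<exists>\<N>. countable \<N> \<and> network X \<N>) \<and>
     (\<forall>\<N> :: nat \<Rightarrow> 'a set set.
        (\<forall>n. countable (\<N> n) \<and> network X (\<N> n)) \<longrightarrow>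
        (\<exists>\<F>. (\<forall>n. finite (\<F> n) \<and> \<F> n \<subseteq> \<N> n) \<and> network X (\<Union>n. \<F> n)))"

definition le_star :: "(nat \<Rightarrow> nat) \<Rightarrow> (nat \<Rightarrow> nat) \<Rightarrow> bool" (infix \<open>\<le>\<^sup>*\<close> 50) where
  "f \<le>\<^sup>* g \<longleftrightarrow> finite {n. \<not> f n \<le> g n}"

definition dominating :: "(nat \<Rightarrow> nat) set \<Rightarrow> bool" where
  "dominating D \<longleftrightarrow> (\<forall>g. \<exists>f\<in>D. g \<le>\<^sup>* f)"

(* Cardinals are represented by well-orders, as in the HOL cardinal library, and are compared
   up to order isomorphism. The description below denotes because the class of cardinals is
   well-ordered, see dominating_number_attained and dominating_number_le. *)
definition dominating_number :: "(nat \<Rightarrow> nat) rel" (\<open>\<dd>\<close>) where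
  "\<dd> = (SOME r. (\<exists>D. dominating D \<and> r = |D| ) \<and> (\<forall>E. dominating E \<longrightarrow> r \<le>o |E| ))"

lemma dominating_number_props:
  "(\<exists>D. dominating D \<and> \<dd> = |D| ) \<and> (\<forall>E. dominating E \<longrightarrow> \<dd> \<le>o |E| )"
proof -
  have "dominating UNIV"
    unfolding dominating_def le_star_def by (metis UNIV_I empty_Collect_eq finite.emptyI order_refl)
  then have "\<exists>r\<in>{|D| |D. dominating D}. \<forall>r'\<in>{|D| |D. dominating D}. r \<le>o r'"
    by (intro exists_minim_Card_order) (auto simp: card_of_Card_order)
  then have "\<exists>r. (\<exists>D. dominating D \<and> r = |D| ) \<and> (\<forall>E. dominating E \<longrightarrow> r \<le>o |E| )"
    by blast
  then show ?thesis
    unfolding dominating_number_def by (rule someI_ex)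
qed

lemma dominating_number_attained: "\<exists>D. dominating D \<and> \<dd> = |D|"
  using dominating_number_props by blast

lemma dominating_number_le: "dominating E \<Longrightarrow> \<dd> \<le>o |E|"
  using dominating_number_props by blast

end

theory Submission
  imports Defs
begin

text \<open>
  The point is that a set \<open>S\<close> with \<open>\<dd> \<le>o |S|\<close> is not Menger even as a discrete set, and that
  countable partitions can be built into networks of any space that has a countable network.

  Adding constants to the members of a dominating family of size \<open>\<dd>\<close> gives a family \<open>E\<close> of
  the same size which dominates at every coordinate, not only at almost every one. By the size
  assumption the points of \<open>X\<close> can be labelled by functions so that every member of \<open>E\<close> occurs as
  a label. Cutting each member of a countable network according to the value of the label at
  coordinate \<open>n\<close> yields a countable network \<open>\<N> n\<close>. The labels of the points covered by a finite
  part of \<open>\<N> n\<close> take only finitely many values at \<open>n\<close>, so a finite selection from every \<open>\<N> n\<close>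
  determines a function \<open>g\<close> with the following property: each point covered by the selection has
  a label that is at most \<open>g\<close> at some coordinate. By the choice of
  \<open>E\<close> some label exceeds \<open>g\<close> everywhere, so a point with that label is missed. Since a network
  covers the space, the selection is not a network.
\<close>

lemma dominating_infinite:
  assumes "dominating D"
  shows "infinite D"
proof
  assume fin: "finite D"
  obtain f where f: "f \<in> D" "(\<lambda>n. Suc (\<Sum>h\<in>D. h n)) \<le>\<^sup>* f"
    using assms unfolding dominating_def by blast
  have "f n \<le> (\<Sum>h\<in>D. h n)" for n
    using member_le_sum[of f D "\<lambda>h. h n"] fin f(1) by simp
  then have "\<not> Suc (\<Sum>h\<in>D. h n) \<le> f n" for n
    by (simp add: not_le less_Suc_eq_le)
  then have "{n. \<not> Suc (\<Sum>h\<in>D. h n) \<le> f n} = UNIV"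
    by simp
  then show False
    using f(2) unfolding le_star_def by simp
qed

lemma le_star_imp_le_shift:
  assumes "g \<le>\<^sup>* f"
  shows "\<exists>m. \<forall>n. g n \<le> f n + m"
proof -
  let ?B = "{n. \<not> g n \<le> f n}"
  have fin: "finite ?B"
    using assms unfolding le_star_def .
  have "g n \<le> f n + (\<Sum>i\<in>?B. g i)" for n
  proof (cases "n \<in> ?B")
    case True
    then have "g n \<le> (\<Sum>i\<in>?B. g i)"
      using fin by (intro member_le_sum) auto
    then show ?thesis by simp
  qed simp
  then show ?thesis by blast
qed

text \<open>
  Only finitely many coordinates are exceptional for \<open>g \<le>\<^sup>* f\<close>, so some constant shift of \<open>f\<close>
  absorbs them. Closing an infinite family under the countably many constant shifts does not
  increase its cardinality.
\<close>

lemma everywhere_dominating_family: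
  "\<exists>E :: (nat \<Rightarrow> nat) set. |E| \<le>o \<dd> \<and> (\<forall>g. \<exists>f\<in>E. \<forall>n. g n \<le> f n)"
proof -
  obtain D where D: "dominating D" "\<dd> = |D|"
    using dominating_number_attained by blast
  define E where "E = (\<lambda>(f, m) n. f n + m) ` (D \<times> (UNIV :: nat set))"
  have inf: "infinite D"
    using D(1) by (rule dominating_infinite)
  then have "|UNIV :: nat set| \<le>o |D|"
    by (simp add: infinite_iff_card_of_nat)
  then have "|D \<times> (UNIV :: nat set)| =o |D|"
    using inf by (intro card_of_Times_infinite[THEN conjunct1]) auto
  then have "|E| \<le>o \<dd>"
    unfolding E_def D(2) by (rule ordLeq_ordIso_trans[OF card_of_image])
  moreover have "\<exists>f\<in>E. \<forall>n. g n \<le> f n" for g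
  proof -
    obtain f where f: "f \<in> D" "g \<le>\<^sup>* f"
      using D(1) unfolding dominating_def by blast
    obtain m where "\<forall>n. g n \<le> f n + m"
      using le_star_imp_le_shift[OF f(2)] by blast
    moreover have "(\<lambda>n. f n + m) \<in> E"
      unfolding E_def using f(1) by force
    ultimately show ?thesis by (rule bexI)
  qed
  ultimately show ?thesis by blast
qed

lemma network_covers:
  assumes "network X \<N>" "x \<in> topspace X"
  shows "\<exists>N\<in>\<N>. x \<in> N"
  using assms openin_topspace unfolding network_def by blast

lemma network_split_by_fibres:
  assumes "network X \<B>"
  shows "network X {N \<inter> {x. c x = k} | N k. N \<in> \<B>}"
  unfolding network_def
proof (intro conjI allI impI)
  show "{N \<inter> {x. c x = k} | N k. N \<in> \<B>} \<subseteq> Pow (topspace X)"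
    using assms unfolding network_def by blast
next
  fix x U
  assume "openin X U \<and> x \<in> U"
  then obtain N where "N \<in> \<B>" "x \<in> N" "N \<subseteq> U"
    using assms unfolding network_def by blast
  then show "\<exists>M\<in>{N \<inter> {x. c x = k} | N k. N \<in> \<B>}. x \<in> M \<and> M \<subseteq> U"
    by (intro bexI[of _ "N \<inter> {y. c y = c x}"]) auto
qed

lemma countable_split_by_fibres:
  fixes c :: "'a \<Rightarrow> 'k :: countable"
  assumes "countable \<B>"
  shows "countable {N \<inter> {x. c x = k} | N k. N \<in> \<B>}"
proof -
  have "{N \<inter> {x. c x = k} | N k. N \<in> \<B>} = (\<lambda>(N, k). N \<inter> {x. c x = k}) ` (\<B> \<times> UNIV)"
    by auto
  then show ?thesis
    using assms by simp
qed

text \<open>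
  Members of a network need not be open, so they can be cut along the fibres of any function
  \<open>\<lambda>x. \<phi> x n\<close> whatsoever. This is why the topology imposes no restriction on \<open>\<phi>\<close>, and why
  the selection principle for networks yields the Menger property of \<open>topspace X\<close> as a
  discrete set.
\<close>

lemma M_nw_selective_imp_not_everywhere_exceeded:
  fixes \<phi> :: "'a \<Rightarrow> nat \<Rightarrow> nat"
  assumes "M_nw_selective X"
  shows "\<exists>g. \<forall>x\<in>topspace X. \<exists>n. \<phi> x n \<le> g n"
proof -
  obtain \<B> where \<B>: "countable \<B>" "network X \<B>"
    using assms unfolding M_nw_selective_def by (elim conjE exE)
  define \<N> where "\<N> n = {N \<inter> {x. \<phi> x n = k} | N k. N \<in> \<B>}" for n
  have "countable (\<N> n) \<and> network X (\<N> n)" for n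
    unfolding \<N>_def
    by (intro conjI countable_split_by_fibres network_split_by_fibres \<B>)
  then have "\<exists>\<F>. (\<forall>n. finite (\<F> n) \<and> \<F> n \<subseteq> \<N> n) \<and> network X (\<Union>n. \<F> n)"
    using assms unfolding M_nw_selective_def by simp
  then obtain \<F> where \<F>: "\<And>n. finite (\<F> n)" "\<And>n. \<F> n \<subseteq> \<N> n" "network X (\<Union>n. \<F> n)"
    by blast
  define V where "V n = (\<Union>N\<in>\<F> n. (\<lambda>x. \<phi> x n) ` N)" for n
  have fin: "finite (V n)" for n
    unfolding V_def
  proof (intro finite_UN_I \<F>(1))
    fix N
    assume "N \<in> \<F> n"
    then obtain k where "(\<lambda>x. \<phi> x n) ` N \<subseteq> {k}"
      using \<F>(2)[of n] unfolding \<N>_def by blast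
    then show "finite ((\<lambda>x. \<phi> x n) ` N)"
      by (rule finite_subset) simp
  qed
  have "\<exists>n. \<phi> x n \<le> Max (V n)" if x: "x \<in> topspace X" for x
  proof -
    obtain n N where "N \<in> \<F> n" "x \<in> N"
      using network_covers[OF \<F>(3) x] by blast
    then have "\<phi> x n \<in> V n"
      unfolding V_def by blast
    then have "\<phi> x n \<le> Max (V n)"
      using fin by (intro Max_ge)
    then show ?thesis ..
  qed
  then show ?thesis
    by (intro exI[of _ "\<lambda>n. Max (V n)"]) blast
qed

theorem proposition2p4:
  fixes X :: "'a topology"
  assumes "\<dd> \<le>o |topspace X|"
  shows "\<not> M_nw_selective X"
proof
  assume sel: "M_nw_selective X"
  obtain E :: "(nat \<Rightarrow> nat) set"
    where E: "|E| \<le>o \<dd>" "\<And>g. \<exists>f\<in>E. \<forall>n. g n \<le> f n"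
    using everywhere_dominating_family by blast
  have "E \<noteq> {}"
    using E(2) by blast
  moreover have "|E| \<le>o |topspace X|"
    using E(1) assms by (rule ordLeq_transitive)
  ultimately have "\<exists>\<phi>. \<phi> ` topspace X = E"
    by (simp add: card_of_ordLeq2)
  then obtain \<phi> where \<phi>: "\<phi> ` topspace X = E" ..
  obtain g where g: "\<forall>x\<in>topspace X. \<exists>n. \<phi> x n \<le> g n"
    using M_nw_selective_imp_not_everywhere_exceeded[OF sel] by blast
  obtain f where "f \<in> E" and f: "\<forall>n. Suc (g n) \<le> f n"
    using E(2)[of "\<lambda>n. Suc (g n)"] by blast
  then obtain x where "x \<in> topspace X" "f = \<phi> x"
    using \<phi> by blast
  then obtain n where "f n \<le> g n"
    using g by blast
  moreover have "Suc (g n) \<le> f n"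
    using f ..
  ultimately show False
    by simp
qed

end
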